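(* Let $\kappa>0$, $h>0$, and let $q,q_1,q_2\in\mathcal{Q}_{\kappa,h}$ be right-continuous functions such that $q\neq0$ and $q_1+q_2\neq0$ (i.e. not identically zero). (i) There exists a random vector $(A,B)$ with $A\ge0$, $\mathbf{E}A^\kappa=1$, $\mathbf{E}[A^\kappa\log_+A]<\infty$, $\log A$ conditioned on $A\ne0$ arithmetic with span $h$, and $\mathbf{E}|B|^\kappa<\infty$, such that the unique (in distribution) solution $X$ of $X\stackrel{\mathcal{D}}{=}AX+B$ (with $(A,B)$ and $X$ on the right-hand side independent) satisfies $$\lim_{n\to\infty}x^\kappa e^{\kappa nh}\,\mathbf{P}\{X>xe^{nh}\}=q_1(x),\quad x\in C_{q_1},$$ $$\lim_{n\to\infty}x^\kappa e^{\kappa nh}\,\mathbf{P}\{X<-xe^{nh}\}=q_2(x),\quad x\in C_{q_2}.$$ (ii) There exists a random vector $(A,B)$ with $A\ge0$, $\mathbf{E}A^\kappa=1$, $\mathbf{E}[A^\kappa\log_+A]<\infty$, $\log A$ conditioned on $A\ne0$ arithmetic with span $h$, and $\mathbf{E}|B|^\kappa<\infty$, such that the unique (in distribution) solution $X$ of $X\stackrel{\mathcal{D}}{=}AX\vee B$ (with $(A,B)$ and $X$ on the right-hand side independent) satisfies, for every $x>0$, $$\lim_{n\to\infty}x^\kappa e^{\kappa nh}\,\mathbf{P}\{X>xe^{nh}\}=q(x).$$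
   Context: $a\vee b=\max\{a,b\}$, $\stackrel{\mathcal{D}}{=}$ is equality in distribution, $\log_+ a=\max\{\log a,0\}$, with $0^\kappa\log_+0=0$. A random variable $Y$ (or its distribution) is arithmetic if $Y\in h\mathbb{Z}$ a.s. for some $h>0$; the largest such $h$ is the span of $Y$. For $\kappa,h>0$, $\mathcal{Q}_{\kappa,h}$ denotes the set of functions $q:(0,\infty)\to[0,\infty)$ such that $x^{-\kappa}q(x)$ is nonincreasing and $q(xe^h)=q(x)$ for all $x>0$. $C_q$ denotes the set of continuity points of $q$. *)

theory Defs
  imports "HOL-Probability.Probability"
begin

text \<open>Functions \<open>(0,\<infinity>) \<rightarrow> [0,\<infinity>)\<close> are represented by functions on all reals whose values outside
  \<open>(0,\<infinity>)\<close> are irrelevant.\<close>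

definition Q_class :: "real \<Rightarrow> real \<Rightarrow> (real \<Rightarrow> real) set" where
  "Q_class \<kappa> h = {q. (\<forall>x>0. q x \<ge> 0)
     \<and> antimono_on {0<..} (\<lambda>x. x powr (- \<kappa>) * q x)
     \<and> (\<forall>x>0. q (x * exp h) = q x)}"

definition right_continuous :: "(real \<Rightarrow> real) \<Rightarrow> bool" where
  "right_continuous q \<longleftrightarrow> (\<forall>x>0. continuous (at_right x) q)"

definition continuity_points :: "(real \<Rightarrow> real) \<Rightarrow> real set" where
  "continuity_points q = {x. x > 0 \<and> isCont q x}"

definition lattice_law :: "real measure \<Rightarrow> real \<Rightarrow> bool" where
  "lattice_law D h \<longleftrightarrow> (AE y in D. \<exists>k::int. y = h * of_int k)"

text \<open>The span is required to be the largest lattice width, so the point mass at 0, which lives on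
  every lattice, has no span.\<close>

definition arithmetic_with_span :: "real measure \<Rightarrow> real \<Rightarrow> bool" where
  "arithmetic_with_span D h \<longleftrightarrow>
     h > 0 \<and> lattice_law D h \<and> (\<forall>h'>0. lattice_law D h' \<longrightarrow> h' \<le> h)"

text \<open>Finiteness of the expectations of the nonnegative variables below is integrability. The
  conventions \<open>0 powr \<kappa> = 0\<close> and \<open>ln 0 = 0\<close> yield the usual readings at \<open>A = 0\<close>. The conditional law
  of \<open>log A\<close> given \<open>A \<noteq> 0\<close> is the image of the normalised restriction of \<open>M\<close>; the conditioning event
  has positive probability because \<open>E A\<^sup>\<kappa> = 1\<close>.\<close>

definition admissible ::
  "real \<Rightarrow> real \<Rightarrow> 'w measure \<Rightarrow> ('w \<Rightarrow> real) \<Rightarrow> ('w \<Rightarrow> real) \<Rightarrow> bool" where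
  "admissible \<kappa> h M A B \<longleftrightarrow>
     prob_space M \<and> A \<in> borel_measurable M \<and> B \<in> borel_measurable M
     \<and> (AE w in M. A w \<ge> 0)
     \<and> integrable M (\<lambda>w. A w powr \<kappa>) \<and> (LINT w|M. A w powr \<kappa>) = 1
     \<and> integrable M (\<lambda>w. A w powr \<kappa> * max (ln (A w)) 0)
     \<and> arithmetic_with_span
         (distr (uniform_measure M {w \<in> space M. A w \<noteq> 0}) borel (\<lambda>w. ln (A w))) h
     \<and> integrable M (\<lambda>w. \<bar>B w\<bar> powr \<kappa>)"

text \<open>\<open>N\<close> is the law of a real random variable \<open>X\<close> equal in distribution to \<open>\<Phi> w X\<close>, where the random
  element \<open>w\<close> with law \<open>M\<close> is independent of \<open>X\<close>: independence is the product measure.\<close>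

definition solution_law :: "'w measure \<Rightarrow> ('w \<Rightarrow> real \<Rightarrow> real) \<Rightarrow> real measure \<Rightarrow> bool" where
  "solution_law M \<Phi> N \<longleftrightarrow>
     prob_space N \<and> sets N = sets borel
     \<and> N = distr (M \<Otimes>\<^sub>M N) borel (\<lambda>(w, x). \<Phi> w x)"

definition unique_solution_law :: "'w measure \<Rightarrow> ('w \<Rightarrow> real \<Rightarrow> real) \<Rightarrow> real measure \<Rightarrow> bool" where
  "unique_solution_law M \<Phi> N \<longleftrightarrow>
     solution_law M \<Phi> N \<and> (\<forall>N'. solution_law M \<Phi> N' \<longrightarrow> N' = N)"

end

theory Submission
  imports Defs "HOL-Real_Asymp.Real_Asymp"
begin

text \<open>Put \<open>p = e\<^sup>-\<^sup>\<kappa>\<^sup>h\<close> and let \<open>(A, B) = (e\<^sup>h, 0)\<close> with probability \<open>p\<close> and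
  \<open>(A, B) = (0, Y)\<close> with probability \<open>1 - p\<close>. Both equations (the second for \<open>Y \<ge> 0\<close>) then say that
  the law of \<open>X\<close> is the mixture, with weights \<open>p\<close> and \<open>1 - p\<close>, of the laws of \<open>e\<^sup>h X\<close> and \<open>Y\<close>, so \<open>X\<close> is distributed as
  \<open>e\<^sup>h\<^sup>T Y\<close> with \<open>T\<close> geometric and independent of \<open>Y\<close>; iterating contracts differences of solutions
  by \<open>p\<close>. The function \<open>G(y) = y\<^sup>-\<^sup>\<kappa> q(y)\<close> is nonincreasing, right-continuous and satisfies
  \<open>G(y e\<^sup>h) = p G(y)\<close>. For large \<open>a\<close> one can choose a bounded \<open>Y\<close> such that the tail of \<open>X\<close> is
  exactly \<open>G(max a y)\<close>, and then \<open>x\<^sup>\<kappa> e\<^sup>\<kappa>\<^sup>n\<^sup>h P(X > x e\<^sup>n\<^sup>h)\<close> equals \<open>q(x)\<close> for all large \<open>n\<close>.\<close>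

section \<open>Images of a product of a discrete law with another law\<close>

text \<open>The index type is countable, so joint measurability follows from that of each
  \<open>\<Phi> i\<close>, and Tonelli evaluates the image law branch by branch. The index will be
  geometric in one use and Bernoulli in the other.\<close>

lemma
  fixes P :: "'i::countable pmf" and \<sigma> :: "'a::topological_space measure"
    and \<Phi> :: "'i \<Rightarrow> 'a \<Rightarrow> 'b"
  assumes \<sigma>: "prob_space \<sigma>" "sets \<sigma> = sets borel" and \<Phi>: "\<And>i. \<Phi> i \<in> borel \<rightarrow>\<^sub>M K"
  shows prob_space_distr_pair_pmf:
      "prob_space (distr (measure_pmf P \<Otimes>\<^sub>M \<sigma>) K (\<lambda>(i, y). \<Phi> i y))"
    and nn_integral_distr_pair_pmf:
      "g \<in> borel_measurable K \<Longrightarrow>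
        (\<integral>\<^sup>+z. g z \<partial>distr (measure_pmf P \<Otimes>\<^sub>M \<sigma>) K (\<lambda>(i, y). \<Phi> i y)) =
        (\<integral>\<^sup>+i. \<integral>\<^sup>+y. g (\<Phi> i y) \<partial>\<sigma> \<partial>measure_pmf P)"
    and emeasure_distr_pair_pmf:
      "S \<in> sets K \<Longrightarrow> emeasure (distr (measure_pmf P \<Otimes>\<^sub>M \<sigma>) K (\<lambda>(i, y). \<Phi> i y)) S =
        (\<integral>\<^sup>+i. emeasure \<sigma> (\<Phi> i -` S) \<partial>measure_pmf P)"
proof -
  interpret \<sigma>: prob_space \<sigma> by fact
  interpret pair_prob_space "measure_pmf P" \<sigma> ..
  have "sets (measure_pmf P \<Otimes>\<^sub>M \<sigma>) = sets (count_space UNIV \<Otimes>\<^sub>M borel)"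
    by (intro sets_pair_measure_cong) (auto simp: \<sigma>)
  then have "measurable (measure_pmf P \<Otimes>\<^sub>M \<sigma>) K = measurable (count_space UNIV \<Otimes>\<^sub>M borel) K"
    by (rule measurable_cong_sets) simp
  then have meas: "(\<lambda>(i, y). \<Phi> i y) \<in> measure_pmf P \<Otimes>\<^sub>M \<sigma> \<rightarrow>\<^sub>M K"
    using \<Phi> by (auto intro!: measurable_pair_measure_countable1)
  show "prob_space (distr (measure_pmf P \<Otimes>\<^sub>M \<sigma>) K (\<lambda>(i, y). \<Phi> i y))"
    by (intro prob_space_distr meas)
  have int: "(\<integral>\<^sup>+z. g z \<partial>distr (measure_pmf P \<Otimes>\<^sub>M \<sigma>) K (\<lambda>(i, y). \<Phi> i y)) =
      (\<integral>\<^sup>+i. \<integral>\<^sup>+y. g (\<Phi> i y) \<partial>\<sigma> \<partial>measure_pmf P)" if g: "g \<in> borel_measurable K" for g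
    using \<sigma>.nn_integral_fst[OF measurable_compose[OF meas g]] g
    by (subst nn_integral_distr[OF meas]) simp_all
  then show "g \<in> borel_measurable K \<Longrightarrow>
      (\<integral>\<^sup>+z. g z \<partial>distr (measure_pmf P \<Otimes>\<^sub>M \<sigma>) K (\<lambda>(i, y). \<Phi> i y)) =
      (\<integral>\<^sup>+i. \<integral>\<^sup>+y. g (\<Phi> i y) \<partial>\<sigma> \<partial>measure_pmf P)" .
  assume S: "S \<in> sets K"
  have sp: "space \<sigma> = UNIV" using sets_eq_imp_space_eq[OF \<sigma>(2)] by simp
  have "\<Phi> i -` S \<inter> space \<sigma> \<in> sets \<sigma>" for i
    using measurable_sets[OF \<Phi> S, of i] by (simp add: \<sigma>(2) sp)
  moreover have "(indicator S (\<Phi> i y) :: ennreal) = indicator (\<Phi> i -` S \<inter> space \<sigma>) y" for i y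
    by (simp add: indicator_def sp)
  ultimately show "emeasure (distr (measure_pmf P \<Otimes>\<^sub>M \<sigma>) K (\<lambda>(i, y). \<Phi> i y)) S =
      (\<integral>\<^sup>+i. emeasure \<sigma> (\<Phi> i -` S) \<partial>measure_pmf P)"
    using int[of "indicator S"] S by (simp add: sp)
qed

section \<open>The mixture equation and its unique solution\<close>

text \<open>A solution is the law of \<open>f\<close> iterated a geometric number of times from a
  point of law \<open>\<sigma>\<close>. On each set two solutions differ by \<open>p\<close> times
  their difference on the preimage under \<open>f\<close>, which forces equality.\<close>

lemma ex1_regenerative_law:
  fixes p :: real and f :: "'a::topological_space \<Rightarrow> 'a" and \<sigma> :: "'a measure"
  assumes p: "0 < p" "p < 1" and f: "f \<in> borel \<rightarrow>\<^sub>M borel"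
    and \<sigma>: "prob_space \<sigma>" "sets \<sigma> = sets borel"
  shows "\<exists>!N. prob_space N \<and> sets N = sets borel \<and>
    (\<forall>S\<in>sets borel. emeasure N S = ennreal p * emeasure N (f -` S) + ennreal (1 - p) * emeasure \<sigma> S)"
    (is "\<exists>!N. ?P N")
proof (rule ex_ex1I)
  define N where "N = distr (measure_pmf (geometric_pmf (1 - p)) \<Otimes>\<^sub>M \<sigma>) borel (\<lambda>(k, y). (f ^^ k) y)"
  have fk: "f ^^ k \<in> borel \<rightarrow>\<^sub>M borel" for k
    by (rule measurable_compose_n) (rule f)
  have NS: "emeasure N S = (\<integral>\<^sup>+k. emeasure \<sigma> ((f ^^ k) -` S) \<partial>geometric_pmf (1 - p))"
    if "S \<in> sets borel" for S
    unfolding N_def by (rule emeasure_distr_pair_pmf[OF \<sigma> fk that])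
  have "prob_space N" unfolding N_def by (rule prob_space_distr_pair_pmf[OF \<sigma> fk])
  moreover have "sets N = sets borel" by (simp add: N_def)
  moreover have "emeasure N S = ennreal p * emeasure N (f -` S) + ennreal (1 - p) * emeasure \<sigma> S"
    if S: "S \<in> sets borel" for S
  proof -
    have fS: "f -` S \<in> sets borel" using measurable_sets[OF f S] by simp
    \<comment> \<open>Condition on the first trial, whose success probability is
      \<open>1 - p\<close>: success means \<open>k = 0\<close>, failure leaves a fresh geometric
      \<open>k\<close> with \<open>S\<close> replaced by its preimage under
      \<open>f\<close>.\<close>
    have "emeasure N S = (\<integral>\<^sup>+b. (if b then emeasure \<sigma> S
        else (\<integral>\<^sup>+k. emeasure \<sigma> ((f ^^ k) -` (f -` S)) \<partial>geometric_pmf (1 - p))) \<partial>bernoulli_pmf (1 - p))"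
      unfolding NS[OF S]
      apply (subst geometric_bind_pmf_unfold)
      using p apply simp
      using p
      by (simp add: vimage_comp)
    also have "\<dots> = ennreal p * emeasure N (f -` S) + ennreal (1 - p) * emeasure \<sigma> S"
      using p by (simp add: NS[OF fS] mult_ac add_ac)
    finally show ?thesis .
  qed
  ultimately show "\<exists>N. ?P N" by blast
next
  fix N N' assume N: "?P N" and N': "?P N'"
  interpret N: prob_space N using N by simp
  interpret N': prob_space N' using N' by simp
  interpret S: prob_space \<sigma> by fact
  have eq: "measure L S = p * measure L (f -` S) + (1 - p) * measure \<sigma> S"
    if "?P L" "S \<in> sets borel" for L S
  proof -
    interpret L: prob_space L using that by simp
    have "ennreal (measure L S) = ennreal (p * measure L (f -` S) + (1 - p) * measure \<sigma> S)"
      using that p by (simp add: L.emeasure_eq_measure S.emeasure_eq_measure ennreal_mult)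
    then show ?thesis using p by (subst (asm) ennreal_inj) auto
  qed
  \<comment> \<open>The bound must hold for all Borel sets at once, since each induction step passes
    from \<open>S\<close> to its preimage.\<close>
  have contr: "\<bar>measure N S - measure N' S\<bar> \<le> p ^ k" if "S \<in> sets borel" for S k
    using that
  proof (induction k arbitrary: S)
    case 0
    then show ?case using N.prob_le_1[of S] N'.prob_le_1[of S] measure_nonneg[of N S] measure_nonneg[of N' S]
      unfolding power_0 abs_le_iff by linarith
  next
    case (Suc k)
    have fS: "f -` S \<in> sets borel" using measurable_sets[OF f Suc.prems] by simp
    have "measure N S - measure N' S = p * (measure N (f -` S) - measure N' (f -` S))"
      using eq[OF N Suc.prems] eq[OF N' Suc.prems] by (simp add: algebra_simps)
    then show ?case using Suc.IH[OF fS] p by (simp add: abs_mult)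
  qed
  show "N = N'"
  proof (rule measure_eqI)
    show "sets N = sets N'" using N N' by simp
    fix S assume "S \<in> sets N"
    then have "\<bar>measure N S - measure N' S\<bar> \<le> p ^ k" for k using contr N by simp
    then have "\<bar>measure N S - measure N' S\<bar> \<le> 0"
      using p by (intro LIMSEQ_le_const[OF LIMSEQ_realpow_zero]) auto
    then show "emeasure N S = emeasure N' S"
      by (simp add: N.emeasure_eq_measure N'.emeasure_eq_measure)
  qed
qed

section \<open>Laws with prescribed tails\<close>

text \<open>The generalised inverse of a nonincreasing tail, to be evaluated at a uniform variable.
  Clamping \<open>u\<close> at 0 keeps the set nonempty for every real \<open>u\<close> as soon as
  \<open>H\<close> has a zero on the half-line.\<close>

definition tail_inverse :: "(real \<Rightarrow> real) \<Rightarrow> real \<Rightarrow> real" where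
  "tail_inverse H u = Inf {y. 0 \<le> y \<and> H y \<le> max 0 u}"

context
  fixes H :: "real \<Rightarrow> real" and b :: real
  assumes H: "antimono_on {0..} H" "\<And>y. 0 \<le> y \<Longrightarrow> continuous (at_right y) H" "0 \<le> b" "H b = 0"
begin

text \<open>If \<open>H y \<le> u\<close>, then \<open>y\<close> lies in the set and bounds its
  infimum from above. If \<open>u < H y\<close>, right continuity preserves this up to some
  \<open>c > y\<close> and monotonicity excludes the points below \<open>y\<close>, so the infimum
  is at least \<open>c\<close>.\<close>

lemma tail_inverse_greater_iff:
  assumes "0 \<le> u" "0 \<le> y"
  shows "y < tail_inverse H u \<longleftrightarrow> u < H y"
proof -
  let ?S = "{y. 0 \<le> y \<and> H y \<le> u}"
  have bdd: "bdd_below ?S" by (auto intro: bdd_belowI[of _ 0])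
  have ne: "?S \<noteq> {}" using H assms by auto
  show ?thesis
  proof
    assume "y < tail_inverse H u"
    then show "u < H y" using cInf_lower[OF _ bdd, of y] assms
      by (force simp: tail_inverse_def max_def)
  next
    assume u: "u < H y"
    have "(H \<longlongrightarrow> H y) (at_right y)" using H(2)[OF assms(2)] by (simp add: continuous_within)
    from order_tendstoD(1)[OF this u] obtain c where c: "c > y" "\<And>z. y < z \<Longrightarrow> z < c \<Longrightarrow> u < H z"
      by (auto simp: eventually_at_right_field)
    have "c \<le> z" if z: "z \<in> ?S" for z
    proof (rule ccontr)
      assume "\<not> c \<le> z"
      then have "z \<le> y" using c(2)[of z] z by force
      then have "H y \<le> H z" using H(1) z assms by (auto simp: monotone_on_def)
      then show False using z u by simp
    qed
    then have "c \<le> tail_inverse H u" unfolding tail_inverse_def using ne assms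
      by (intro cInf_greatest) auto
    then show "y < tail_inverse H u" using c by simp
  qed
qed

lemma tail_inverse_nonneg: "0 \<le> tail_inverse H u"
  unfolding tail_inverse_def using H by (intro cInf_greatest) auto

text \<open>Each set where the function exceeds a given level is empty, a half-line or the whole
  line.\<close>

lemma borel_measurable_tail_inverse: "tail_inverse H \<in> borel_measurable borel"
proof (rule borel_measurableI_greater)
  fix y
  have "{x. y < tail_inverse H x} = (if y < 0 then UNIV else {..<H y})" if "y < 0 \<or> 0 < H y"
  proof -
    have "tail_inverse H x = tail_inverse H (max 0 x)" for x by (simp add: tail_inverse_def)
    then show ?thesis
      using tail_inverse_greater_iff[of "max 0 _" y] tail_inverse_nonneg that
      by (auto intro: less_le_trans)
  qed
  moreover have "{x. y < tail_inverse H x} = {}" if "\<not> (y < 0 \<or> 0 < H y)"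
  proof -
    have "tail_inverse H x = tail_inverse H (max 0 x)" for x by (simp add: tail_inverse_def)
    then show ?thesis
      using tail_inverse_greater_iff[of "max 0 _" y] that by (metis (no_types, lifting) Collect_empty_eq
        max.cobounded1 not_less max_less_iff_conj)
  qed
  ultimately show "{x \<in> space borel. y < tail_inverse H x} \<in> sets borel"
    by (cases "y < 0 \<or> 0 < H y") auto
qed

end

text \<open>One uniform variable \<open>u\<close> carries both tails: values of \<open>u\<close>
  near 0 produce the positive part, values near 1 the negative part, and the remaining mass sits at
  0.\<close>

lemma ex_law_with_tails:
  fixes H1 H2 :: "real \<Rightarrow> real"
  assumes H1: "antimono_on {0..} H1" "\<And>y. 0 \<le> y \<Longrightarrow> continuous (at_right y) H1"
    and H2: "antimono_on {0..} H2" "\<And>y. 0 \<le> y \<Longrightarrow> continuous (at_right y) H2"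
    and nonneg: "\<And>y. 0 \<le> H1 y" "\<And>y. 0 \<le> H2 y"
    and b: "0 \<le> b" "H1 b = 0" "H2 b = 0"
    and total: "H1 0 + H2 0 \<le> 1"
  obtains \<rho> :: "real measure" where "prob_space \<rho>" "sets \<rho> = sets borel"
    "\<And>y. 0 \<le> y \<Longrightarrow> measure \<rho> {y<..} = H1 y" "\<And>y. 0 \<le> y \<Longrightarrow> measure \<rho> {..<- y} = H2 y"
proof -
  define U where "U = uniform_measure lborel {0..1::real}"
  define X where "X u = tail_inverse H1 u - tail_inverse H2 (1 - u)" for u
  \<comment> \<open>The two terms of \<open>X\<close> are never both nonzero on \<open>{0..1}\<close>, as \<open>H1 0 + H2 0 \<le> 1\<close>.\<close>
  note I1 = H1 b(1,2) and I2 = H2 b(1,3)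
  note [measurable] = borel_measurable_tail_inverse[OF I1] borel_measurable_tail_inverse[OF I2]
  interpret U: prob_space U unfolding U_def by (rule prob_space_uniform_measure) auto
  have sU[measurable_cong]: "sets U = sets borel" by (simp add: U_def)
  have [measurable]: "X \<in> U \<rightarrow>\<^sub>M borel" unfolding X_def by measurable
  have le: "H1 y \<le> H1 0" "H2 y \<le> H2 0" if "0 \<le> y" for y
    using H1(1) H2(1) that by (auto simp: monotone_on_def)
  have z1: "tail_inverse H1 u = 0" if "0 \<le> u" "H1 0 \<le> u" for u
    using tail_inverse_nonneg[OF I1, of u] tail_inverse_greater_iff[OF I1 that(1), of 0] that by simp
  have z2: "tail_inverse H2 u = 0" if "0 \<le> u" "H2 0 \<le> u" for u
    using tail_inverse_nonneg[OF I2, of u] tail_inverse_greater_iff[OF I2 that(1), of 0] that by simp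
  have pos: "y < X u \<longleftrightarrow> u < H1 y" if u: "u \<in> {0..1}" and y: "0 \<le> y" for u y
  proof (cases "u < H1 0")
    case True
    then have "tail_inverse H2 (1 - u) = 0" using u total by (intro z2) auto
    then show ?thesis using tail_inverse_greater_iff[OF I1, of u y] u y by (simp add: X_def)
  next
    case False
    then have "tail_inverse H1 u = 0" using u by (intro z1) auto
    then show ?thesis using tail_inverse_nonneg[OF I2, of "1 - u"] False le(1)[OF y] y
      by (simp add: X_def)
  qed
  have neg: "X u < - y \<longleftrightarrow> 1 - u < H2 y" if u: "u \<in> {0..1}" and y: "0 \<le> y" for u y
  proof (cases "1 - u < H2 0")
    case True
    then have "tail_inverse H1 u = 0" using u total by (intro z1) auto
    then show ?thesis using tail_inverse_greater_iff[OF I2, of "1 - u" y] u y by (simp add: X_def)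
  next
    case False
    then have "tail_inverse H2 (1 - u) = 0" using u by (intro z2) auto
    then show ?thesis using tail_inverse_nonneg[OF I1, of u] False le(2)[OF y] y
      by (simp add: X_def)
  qed
  have meas: "measure (distr U borel X) S = measure lborel ({0..1} \<inter> {u. X u \<in> S})"
    if [measurable]: "S \<in> sets borel" for S
  proof -
    have "X -` S \<inter> space U \<in> sets U" by measurable
    then have "{u. X u \<in> S} \<in> sets lborel" by (simp add: U_def vimage_def)
    then have "measure U {u. X u \<in> S} = measure lborel ({0..1} \<inter> {u. X u \<in> S})"
      unfolding U_def by (subst measure_uniform_measure) auto
    then show ?thesis by (simp add: measure_distr vimage_def U_def)
  qed
  show thesis
  proof
    show "prob_space (distr U borel X)" by (rule U.prob_space_distr) simp
    show "sets (distr U borel X) = sets borel" by simp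
    fix y :: real assume y: "0 \<le> y"
    \<comment> \<open>By \<open>total\<close>, \<open>H1 y \<le> 1\<close>, so the interval is not
      cut off by the unit interval and has length exactly \<open>H1 y\<close>.\<close>
    have "{0..1} \<inter> {u. X u \<in> {y<..}} = {0..<H1 y}"
      using pos[OF _ y] le(1)[OF y] le(2)[of 0] total nonneg(2)[of 0] by auto
    then show "measure (distr U borel X) {y<..} = H1 y"
      using meas[of "{y<..}"] nonneg by simp
    have "{0..1} \<inter> {u. X u \<in> {..<- y}} = {1 - H2 y<..1}"
      using neg[OF _ y] le(2)[OF y] le(1)[of 0] total nonneg(1)[of 0] by auto
    then show "measure (distr U borel X) {..<- y} = H2 y"
      using meas[of "{..<- y}"] nonneg by simp
  qed
qed

section \<open>The random environment that either multiplies or restarts\<close>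

text \<open>This is the joint law of \<open>(A, B)\<close> on the plane, so \<open>A\<close> and
  \<open>B\<close> become \<open>fst\<close> and \<open>snd\<close>; \<open>c\<close> stands for the
  factor \<open>e^h\<close> and \<open>\<rho>\<close> for the law of \<open>Y\<close>.\<close>

definition restart_env :: "real \<Rightarrow> real \<Rightarrow> real measure \<Rightarrow> (real \<times> real) measure" where
  "restart_env p c \<rho> = distr (measure_pmf (bernoulli_pmf p) \<Otimes>\<^sub>M \<rho>) (borel \<Otimes>\<^sub>M borel)
     (\<lambda>(i, y). if i then (c, 0) else (0, y))"

context
  fixes p c :: real and \<rho> :: "real measure"
  assumes p: "0 < p" "p < 1" and c: "1 < c" and \<rho>: "prob_space \<rho>" "sets \<rho> = sets borel"
begin

lemma sets_restart_env: "sets (restart_env p c \<rho>) = sets (borel \<Otimes>\<^sub>M borel)"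
  by (simp add: restart_env_def)

lemma restart_env_branch_measurable: "(\<lambda>y. if i then (c, 0) else (0, y)) \<in> borel \<rightarrow>\<^sub>M borel \<Otimes>\<^sub>M borel"
  by (cases i) simp_all

lemma prob_space_restart_env: "prob_space (restart_env p c \<rho>)"
  unfolding restart_env_def
  by (rule prob_space_distr_pair_pmf[OF \<rho> restart_env_branch_measurable])

lemma nn_integral_restart_env:
  assumes "g \<in> borel_measurable (borel \<Otimes>\<^sub>M borel)"
  shows "(\<integral>\<^sup>+w. g w \<partial>restart_env p c \<rho>) = ennreal p * g (c, 0) + ennreal (1 - p) * (\<integral>\<^sup>+y. g (0, y) \<partial>\<rho>)"
proof -
  have "emeasure \<rho> (space \<rho>) = 1" using \<rho>(1) by (rule prob_space.emeasure_space_1)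
  then show ?thesis
    unfolding restart_env_def
      nn_integral_distr_pair_pmf[OF \<rho> restart_env_branch_measurable assms]
    using p by (simp add: mult_ac)
qed

text \<open>Both branches have positive weight, so an exceptional set is null exactly when it misses
  the atom \<open>(c, 0)\<close> and is null in the \<open>\<rho>\<close> branch.\<close>

lemma AE_restart_env_iff:
  assumes "Measurable.pred (borel \<Otimes>\<^sub>M borel) P"
  shows "(AE w in restart_env p c \<rho>. P w) \<longleftrightarrow> P (c, 0) \<and> (AE y in \<rho>. P (0, y))"
proof -
  note [measurable] = assms
  note [measurable_cong] = \<rho>(2) sets_restart_env
  have "(AE w in restart_env p c \<rho>. P w) \<longleftrightarrow>
      (\<integral>\<^sup>+w. indicator {w. \<not> P w} w \<partial>restart_env p c \<rho>) = 0"
    by (subst nn_integral_0_iff_AE) (auto simp: indicator_def)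
  also have "\<dots> \<longleftrightarrow> P (c, 0) \<and> (\<integral>\<^sup>+y. indicator {w. \<not> P w} (0, y) \<partial>\<rho>) = 0"
    using p by (subst nn_integral_restart_env) (auto simp: indicator_def)
  also have "(\<integral>\<^sup>+y. indicator {w. \<not> P w} (0, y) \<partial>\<rho>) = 0 \<longleftrightarrow> (AE y in \<rho>. P (0, y))"
    by (subst nn_integral_0_iff_AE) (auto simp: indicator_def)
  finally show ?thesis .
qed

text \<open>Conditioning on \<open>A \<noteq> 0\<close> leaves only \<open>A = c\<close>, so
  \<open>ln A\<close> is the constant \<open>ln c\<close>. As \<open>ln c > 0\<close>, it is a
  positive integer multiple of every admissible lattice width, and the largest such width is
  \<open>ln c\<close> itself.\<close>

lemma restart_env_log_span:
  "arithmetic_with_span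
     (distr (uniform_measure (restart_env p c \<rho>) {w \<in> space (restart_env p c \<rho>). fst w \<noteq> 0})
       borel (\<lambda>w. ln (fst w))) (ln c)"
proof -
  let ?M = "restart_env p c \<rho>"
  note [measurable_cong] = sets_restart_env
  interpret prob_space ?M by (rule prob_space_restart_env)
  have "\<not> (AE w in ?M. fst w = 0)"
    using c by (subst AE_restart_env_iff) auto
  then have ne: "emeasure ?M {w \<in> space ?M. fst w \<noteq> 0} \<noteq> 0"
    by (subst (asm) AE_iff_measurable[OF _ refl]) auto
  have lattice: "lattice_law (distr (uniform_measure ?M {w \<in> space ?M. fst w \<noteq> 0}) borel
      (\<lambda>w. ln (fst w))) h' \<longleftrightarrow> (\<exists>k::int. ln c = h' * of_int k)" for h'
  proof -
    have "lattice_law (distr (uniform_measure ?M {w \<in> space ?M. fst w \<noteq> 0}) borel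
        (\<lambda>w. ln (fst w))) h' \<longleftrightarrow>
        (AE w in ?M. w \<in> {w \<in> space ?M. fst w \<noteq> 0} \<longrightarrow> (\<exists>k::int. ln (fst w) = h' * of_int k))"
      unfolding lattice_law_def
      by (subst AE_distr_iff, simp, simp, subst AE_uniform_measure)
        (use ne in \<open>auto simp: emeasure_eq_measure\<close>)
    also have "\<dots> \<longleftrightarrow> (AE w in ?M. fst w \<noteq> 0 \<longrightarrow> (\<exists>k::int. ln (fst w) = h' * of_int k))"
      by (simp add: sets_eq_imp_space_eq[OF sets_restart_env] space_pair_measure)
    also have "\<dots> \<longleftrightarrow> (\<exists>k::int. ln c = h' * of_int k)"
      using c by (subst AE_restart_env_iff) auto
    finally show ?thesis .
  qed
  have "h' \<le> ln c" if "0 < h'" "ln c = h' * of_int k" for h' and k :: int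
  proof -
    have "0 < h' * of_int k" using that c by (metis ln_gt_zero)
    then have "0 < k" using that by (simp add: zero_less_mult_iff)
    then show ?thesis using that by simp
  qed
  moreover have "ln c = ln c * of_int 1" by simp
  ultimately show ?thesis
    using c unfolding arithmetic_with_span_def lattice by (metis ln_gt_zero)
qed

text \<open>All the variables involved are almost surely bounded, hence integrable. The branch
  \<open>A = 0\<close> contributes nothing to the moment of order \<open>\<kappa>\<close>, because
  \<open>0 powr \<kappa> = 0\<close>, so this moment is \<open>p * c powr \<kappa>\<close>.\<close>

lemma admissible_restart_env:
  assumes \<kappa>: "p * c powr \<kappa> = 1" "0 < \<kappa>" and bdd: "AE y in \<rho>. \<bar>y\<bar> \<le> b"
  shows "admissible \<kappa> (ln c) (restart_env p c \<rho>) fst snd"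
proof -
  let ?M = "restart_env p c \<rho>"
  note [measurable_cong] = sets_restart_env
  interpret prob_space ?M by (rule prob_space_restart_env)
  have "AE w in ?M. fst w \<ge> 0"
    using c by (subst AE_restart_env_iff) auto
  moreover have "integrable ?M (\<lambda>w. fst w powr \<kappa>)"
    using c by (intro integrable_const_bound[where B="c powr \<kappa>"])
      (subst AE_restart_env_iff, auto)
  moreover have "(LINT w|?M. fst w powr \<kappa>) = 1"
  proof -
    have "(LINT w|?M. fst w powr \<kappa>) = enn2real (\<integral>\<^sup>+w. ennreal (fst w powr \<kappa>) \<partial>?M)"
      by (rule integral_eq_nn_integral) auto
    also have "\<dots> = enn2real (ennreal p * ennreal (c powr \<kappa>))"
      using \<kappa> by (subst nn_integral_restart_env) auto
    also have "\<dots> = 1"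
      using \<kappa> p by (simp add: ennreal_mult[symmetric])
    finally show ?thesis .
  qed
  moreover have "integrable ?M (\<lambda>w. fst w powr \<kappa> * max (ln (fst w)) 0)"
    using c by (intro integrable_const_bound[where B="c powr \<kappa> * ln c"])
      (subst AE_restart_env_iff, auto)
  moreover have "integrable ?M (\<lambda>w. \<bar>snd w\<bar> powr \<kappa>)"
  proof (rule integrable_const_bound[where B="b powr \<kappa>"])
    have "AE y in \<rho>. norm (\<bar>y\<bar> powr \<kappa>) \<le> b powr \<kappa>"
      using bdd by eventually_elim (use \<kappa> in \<open>auto intro: powr_mono2\<close>)
    then show "AE w in ?M. norm (\<bar>snd w\<bar> powr \<kappa>) \<le> b powr \<kappa>"
      by (subst AE_restart_env_iff) auto
  qed measurable
  ultimately show ?thesis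
    unfolding admissible_def using restart_env_log_span prob_space_restart_env by simp
qed

text \<open>Splitting over the two branches turns the distributional equation into that of
  \<open>ex1_regenerative_law\<close>; \<open>restart\<close> expresses that the branch
  \<open>A = 0\<close> forgets the old value. An abstract \<open>\<Phi>\<close> covers the affine
  and the maximum equation together.\<close>

lemma solution_law_restart_env_iff:
  assumes \<Phi>: "(\<lambda>(w, x). \<Phi> w x) \<in> (borel \<Otimes>\<^sub>M borel) \<Otimes>\<^sub>M borel \<rightarrow>\<^sub>M borel"
    and restart: "\<And>y x. \<Phi> (0, y) x = \<Phi> (0, y) 0"
  shows "solution_law (restart_env p c \<rho>) \<Phi> N \<longleftrightarrow> prob_space N \<and> sets N = sets borel \<and>
    (\<forall>S\<in>sets borel. emeasure N S = ennreal p * emeasure N (\<Phi> (c, 0) -` S) +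
      ennreal (1 - p) * emeasure (distr \<rho> borel (\<lambda>y. \<Phi> (0, y) 0)) S)"
proof (cases "prob_space N \<and> sets N = sets borel")
  case True
  then interpret N: prob_space N by simp
  let ?M = "restart_env p c \<rho>"
  have sN[measurable_cong]: "sets N = sets borel" using True by simp
  have spN: "space N = UNIV" using sets_eq_imp_space_eq[OF sN] by simp
  note [measurable_cong] = sets_restart_env \<rho>(2)
  note [measurable] = \<Phi>
  have \<Phi>': "(\<lambda>(w, x). \<Phi> w x) \<in> ?M \<Otimes>\<^sub>M N \<rightarrow>\<^sub>M borel"
    using \<Phi> by (subst measurable_cong_sets[OF sets_pair_measure_cong[OF sets_restart_env sN] refl])
  have "emeasure (distr (?M \<Otimes>\<^sub>M N) borel (\<lambda>(w, x). \<Phi> w x)) S =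
      ennreal p * emeasure N (\<Phi> (c, 0) -` S) +
      ennreal (1 - p) * emeasure (distr \<rho> borel (\<lambda>y. \<Phi> (0, y) 0)) S" if S[measurable]: "S \<in> sets borel" for S
  proof -
    have fib: "(\<integral>\<^sup>+x. indicator S (\<Phi> w x) \<partial>N) = emeasure N (\<Phi> w -` S)" for w
    proof -
      have "\<Phi> w \<in> N \<rightarrow>\<^sub>M borel"
        using measurable_Pair2[OF \<Phi>'] by (simp add: sets_eq_imp_space_eq[OF sets_restart_env] space_pair_measure)
      from measurable_sets[OF this S] have "\<Phi> w -` S \<in> sets N" by (simp add: spN)
      moreover have "(indicator S (\<Phi> w x) :: ennreal) = indicator (\<Phi> w -` S) x" for x by (simp add: indicator_def)
      ultimately show ?thesis by simp
    qed
    have "emeasure (distr (?M \<Otimes>\<^sub>M N) borel (\<lambda>(w, x). \<Phi> w x)) S =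
        (\<integral>\<^sup>+z. indicator S z \<partial>distr (?M \<Otimes>\<^sub>M N) borel (\<lambda>(w, x). \<Phi> w x))" by simp
    also have "\<dots> = (\<integral>\<^sup>+z. indicator S ((\<lambda>(w, x). \<Phi> w x) z) \<partial>(?M \<Otimes>\<^sub>M N))"
      by (rule nn_integral_distr) measurable
    also have "\<dots> = (\<integral>\<^sup>+w. \<integral>\<^sup>+x. indicator S (\<Phi> w x) \<partial>N \<partial>?M)"
      by (subst N.nn_integral_fst[symmetric]) auto
    also have "\<dots> = ennreal p * (\<integral>\<^sup>+x. indicator S (\<Phi> (c, 0) x) \<partial>N) +
        ennreal (1 - p) * (\<integral>\<^sup>+y. \<integral>\<^sup>+x. indicator S (\<Phi> (0, y) x) \<partial>N \<partial>\<rho>)"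
      by (rule nn_integral_restart_env) measurable
    \<comment> \<open>After a restart the inner integrand is constant in \<open>x\<close>, and
      \<open>N\<close> has total mass 1.\<close>
    also have "(\<integral>\<^sup>+y. \<integral>\<^sup>+x. indicator S (\<Phi> (0, y) x) \<partial>N \<partial>\<rho>) = (\<integral>\<^sup>+y. indicator S (\<Phi> (0, y) 0) \<partial>\<rho>)"
      by (subst restart) (simp add: N.emeasure_space_1)
    also have "\<dots> = emeasure (distr \<rho> borel (\<lambda>y. \<Phi> (0, y) 0)) S"
      by (subst nn_integral_indicator[symmetric], simp, subst nn_integral_distr) auto
    finally show ?thesis unfolding fib .
  qed
  moreover have "N = distr (?M \<Otimes>\<^sub>M N) borel (\<lambda>(w, x). \<Phi> w x) \<longleftrightarrow>
      (\<forall>S\<in>sets borel. emeasure N S = emeasure (distr (?M \<Otimes>\<^sub>M N) borel (\<lambda>(w, x). \<Phi> w x)) S)"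
    by (auto intro!: measure_eqI simp: sN)
  ultimately show ?thesis using True by (simp add: solution_law_def)
qed (auto simp: solution_law_def)

lemma ex_unique_solution_restart_env:
  assumes \<Phi>: "(\<lambda>(w, x). \<Phi> w x) \<in> (borel \<Otimes>\<^sub>M borel) \<Otimes>\<^sub>M borel \<rightarrow>\<^sub>M borel"
    and restart: "\<And>y x. \<Phi> (0, y) x = \<Phi> (0, y) 0"
  obtains N where "unique_solution_law (restart_env p c \<rho>) \<Phi> N" "prob_space N"
    "\<And>S. S \<in> sets borel \<Longrightarrow> measure N S =
       p * measure N (\<Phi> (c, 0) -` S) + (1 - p) * measure \<rho> ((\<lambda>y. \<Phi> (0, y) 0) -` S)"
proof -
  interpret \<rho>: prob_space \<rho> by (rule \<rho>)
  let ?\<sigma> = "distr \<rho> borel (\<lambda>y. \<Phi> (0, y) 0)"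
  have g: "(\<lambda>y. \<Phi> (0, y) 0) \<in> \<rho> \<rightarrow>\<^sub>M borel"
  proof -
    note [measurable_cong] = \<rho>(2)
    have "(\<lambda>y. ((0, y), 0)) \<in> \<rho> \<rightarrow>\<^sub>M (borel \<Otimes>\<^sub>M borel) \<Otimes>\<^sub>M borel" by measurable
    from measurable_compose[OF this \<Phi>] show ?thesis by simp
  qed
  have f: "\<Phi> (c, 0) \<in> borel \<rightarrow>\<^sub>M borel"
    using measurable_Pair2[OF \<Phi>, of "(c, 0)"] by (simp add: space_pair_measure)
  have \<sigma>: "prob_space ?\<sigma>" "sets ?\<sigma> = sets borel" using g by (auto intro: \<rho>.prob_space_distr)
  from ex1_regenerative_law[OF p f \<sigma>] obtain N where
    N: "solution_law (restart_env p c \<rho>) \<Phi> N"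
      "\<And>N'. solution_law (restart_env p c \<rho>) \<Phi> N' \<Longrightarrow> N' = N"
    unfolding solution_law_restart_env_iff[OF \<Phi> restart, symmetric] by blast
  show thesis
  proof
    show "unique_solution_law (restart_env p c \<rho>) \<Phi> N"
      unfolding unique_solution_law_def using N by blast
    show "prob_space N" using N(1) by (simp add: solution_law_def)
    interpret N: prob_space N by fact
    interpret \<sigma>: prob_space ?\<sigma> by (rule \<sigma>)
    fix S :: "real set" assume S: "S \<in> sets borel"
    have "ennreal (measure N S) = ennreal (p * measure N (\<Phi> (c, 0) -` S) + (1 - p) * measure ?\<sigma> S)"
      using N(1) S p unfolding solution_law_restart_env_iff[OF \<Phi> restart]
      by (simp add: N.emeasure_eq_measure \<sigma>.emeasure_eq_measure ennreal_mult)
    then have "measure N S = p * measure N (\<Phi> (c, 0) -` S) + (1 - p) * measure ?\<sigma> S"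
      using p by (subst (asm) ennreal_inj) auto
    then show "measure N S =
       p * measure N (\<Phi> (c, 0) -` S) + (1 - p) * measure \<rho> ((\<lambda>y. \<Phi> (0, y) 0) -` S)"
      using g S sets_eq_imp_space_eq[OF \<rho>(2)] by (simp add: measure_distr)
  qed
qed

end

section \<open>The recursion for the tails\<close>

text \<open>The target \<open>G (max a y)\<close> satisfies the same recursion as \<open>T\<close>.
  Their difference at \<open>y\<close> is therefore \<open>p\<close> times the difference at
  \<open>y / c\<close>, and it is bounded uniformly in \<open>y\<close>, so it vanishes.\<close>

lemma tail_recursion_solution:
  fixes T G :: "real \<Rightarrow> real"
  assumes p: "0 < p" "p < 1" and c: "1 < c" and a: "0 < a"
    and G: "antimono_on {0<..} G" "\<And>y. 0 < y \<Longrightarrow> 0 \<le> G y" "\<And>y. 0 < y \<Longrightarrow> G (y * c) = p * G y"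
    and T: "\<And>y. 0 \<le> T y" "\<And>y. T y \<le> 1"
    and rec: "\<And>y. 0 < y \<Longrightarrow> T y = p * T (y / c) + max 0 (G (max a y) - G (a * c))"
    and y: "0 < y"
  shows "T y = G (max a y)"
proof -
  have mono: "G v \<le> G u" if "0 < u" "u \<le> v" for u v using G(1) that by (auto simp: monotone_on_def)
  \<comment> \<open>Three regimes, all resting on \<open>G (a * c) = p * G a\<close>: up to
    \<open>a\<close> the target is constant; up to \<open>a * c\<close> its value at
    \<open>z / c\<close> is still \<open>G a\<close>; beyond that the maximum is 0 and the scaling
    of \<open>G\<close> alone gives the identity.\<close>
  have sol: "G (max a z) = p * G (max a (z / c)) + max 0 (G (max a z) - G (a * c))" if z: "0 < z" for z
  proof -
    have zc: "z / c \<le> z" using z c by (simp add: field_simps)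
    consider "z \<le> a" | "a < z" "z \<le> a * c" | "a * c < z" by linarith
    then show ?thesis
    proof cases
      case 1
      then have "G (max a z) = G a" "G (max a (z / c)) = G a" using zc by (simp_all add: max_absorb1)
      then show ?thesis using G(3)[OF a] mono[of a "a * c"] a c by simp
    next
      case 2
      then have "z / c \<le> a" using c by (simp add: field_simps)
      then have "G (max a (z / c)) = G a" "G (max a z) = G z" using 2 by (simp_all add: max_absorb1 max_absorb2)
      then show ?thesis using G(3)[OF a] mono[of z "a * c"] 2 z by simp
    next
      case 3
      then have "a < z / c" using c by (simp add: field_simps)
      moreover from this have "a < z" using zc by simp
      moreover from this have "G z = p * G (z / c)" using G(3)[of "z / c"] z c by simp
      ultimately show ?thesis using mono[of "a * c" z] 3 a c by simp
    qed
  qed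
  \<comment> \<open>The constant adds the bound 1 on \<open>T\<close> to the bound
    \<open>G a\<close> on the target; it does not depend on \<open>z\<close>, which the induction
    replaces by \<open>z / c\<close>.\<close>
  have "\<bar>T z - G (max a z)\<bar> \<le> p ^ k * (1 + G a)" if "0 < z" for z k
    using that
  proof (induction k arbitrary: z)
    case 0
    have "0 \<le> G (max a z)" "G (max a z) \<le> G a" using a mono[of a "max a z"] G(2)[of "max a z"] by auto
    then show ?case using T[of z] by simp
  next
    case (Suc k)
    have "T z - G (max a z) = p * (T (z / c) - G (max a (z / c)))"
      using rec[OF Suc.prems] sol[OF Suc.prems] by (simp add: algebra_simps)
    then show ?case using Suc.IH[of "z / c"] Suc.prems p c by (simp add: abs_mult mult.assoc)
  qed
  moreover have "(\<lambda>k. p ^ k * (1 + G a)) \<longlonglongrightarrow> 0"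
    using p by (intro tendsto_mult_left_zero LIMSEQ_realpow_zero) auto
  ultimately have "\<bar>T y - G (max a y)\<bar> \<le> 0"
    using y by (intro LIMSEQ_le_const) auto
  then show ?thesis by simp
qed

section \<open>Tails built from log-periodic functions\<close>

lemma
  assumes "q \<in> Q_class \<kappa> h"
  defines "G \<equiv> \<lambda>y. y powr (- \<kappa>) * q y"
  shows Q_class_tail_antimono: "antimono_on {0<..} G"
    and Q_class_tail_nonneg: "0 < y \<Longrightarrow> 0 \<le> G y"
    and Q_class_tail_scale: "0 < y \<Longrightarrow> G (y * exp h) = exp (- \<kappa> * h) * G y"
    and Q_class_tail_right_continuous:
      "right_continuous q \<Longrightarrow> 0 < y \<Longrightarrow> continuous (at_right y) G"
proof -
  have G: "antimono_on {0<..} G" "\<And>y. 0 < y \<Longrightarrow> 0 \<le> q y" "\<And>y. 0 < y \<Longrightarrow> q (y * exp h) = q y"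
    using assms by (auto simp: Q_class_def)
  then show "antimono_on {0<..} G" "0 < y \<Longrightarrow> 0 \<le> G y" by (auto simp: G_def)
  show "0 < y \<Longrightarrow> G (y * exp h) = exp (- \<kappa> * h) * G y"
    using G(3)[of y] by (simp add: G_def powr_mult) (simp add: powr_def)
  show "continuous (at_right y) G" if "right_continuous q" "0 < y"
    unfolding G_def using that
    by (intro continuous_intros) (auto simp: right_continuous_def)
qed

lemma Q_class_tail_scale_power:
  assumes "q \<in> Q_class \<kappa> h" "0 < y"
  shows "(y * exp (real n * h)) powr (- \<kappa>) * q (y * exp (real n * h)) =
    exp (- \<kappa> * h) ^ n * (y powr (- \<kappa>) * q y)"
proof (induction n)
  case (Suc n)
  have eq: "y * exp (real (Suc n) * h) = y * exp (real n * h) * exp h"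
    by (simp add: exp_add[symmetric] algebra_simps)
  show ?case
    using Suc.IH Q_class_tail_scale[OF assms(1), of "y * exp (real n * h)"] assms(2)
    unfolding eq by (simp add: mult.assoc)
qed simp

text \<open>The sequence is eventually constant: once \<open>x * exp (n * h)\<close> reaches
  \<open>a\<close>, the geometric decay of the tail cancels the prefactor exactly. Hence the limit
  exists at every \<open>x > 0\<close>.\<close>

lemma Q_class_tail_limit:
  assumes q: "q \<in> Q_class \<kappa> h" and "0 < h" "0 < x"
    and T: "\<And>y. 0 < y \<Longrightarrow> T y = max a y powr (- \<kappa>) * q (max a y)"
  shows "(\<lambda>n. x powr \<kappa> * exp (\<kappa> * real n * h) * T (x * exp (real n * h))) \<longlonglongrightarrow> q x"
proof (rule tendsto_eventually)
  have "filterlim (\<lambda>n. x * exp (real n * h)) at_top sequentially"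
    using assms(2,3) by real_asymp
  then have "eventually (\<lambda>n. a \<le> x * exp (real n * h)) sequentially"
    by (simp add: filterlim_at_top)
  then show "\<forall>\<^sub>F n in sequentially. x powr \<kappa> * exp (\<kappa> * real n * h) * T (x * exp (real n * h)) = q x"
  proof eventually_elim
    case (elim n)
    have "x powr \<kappa> * x powr (- \<kappa>) = 1" using assms by (simp add: powr_add[symmetric])
    moreover have "exp (\<kappa> * real n * h) * exp (- \<kappa> * h) ^ n = 1"
      by (simp add: exp_of_nat_mult[symmetric] exp_add[symmetric] algebra_simps)
    ultimately show ?case
      using elim assms(3) T[of "x * exp (real n * h)"] Q_class_tail_scale_power[OF q assms(3), where n=n]
      by (simp add: max_absorb2) (metis (no_types, opaque_lifting) mult.assoc mult.commute mult.left_neutral)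
  qed
qed

text \<open>\<open>(1 - p) H(y)\<close> is the discrepancy \<open>K(y) - p K(y e\<^sup>-\<^sup>h)\<close> of the target tail
  \<open>K(y) = G(max a y)\<close>; it vanishes for \<open>y \<ge> a e\<^sup>h\<close>.\<close>

lemma Q_class_restart_tail:
  fixes q :: "real \<Rightarrow> real"
  assumes q: "q \<in> Q_class \<kappa> h" "right_continuous q" and \<kappa>: "0 < \<kappa>" and h: "0 < h" and "0 < a"
  defines "G \<equiv> \<lambda>y. y powr (- \<kappa>) * q y"
  defines "H \<equiv> \<lambda>y. max 0 (G (max a y) - G (a * exp h)) / (1 - exp (- \<kappa> * h))"
  shows "antimono_on {0..} H" "\<And>y. 0 \<le> y \<Longrightarrow> continuous (at_right y) H" "\<And>y. 0 \<le> H y"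
    "H (a * exp h) = 0" "H 0 = G a"
proof -
  have p: "exp (- \<kappa> * h) < 1" using assms by simp
  have mono: "G v \<le> G u" if "0 < u" "u \<le> v" for u v
    using Q_class_tail_antimono[OF q(1)] that by (auto simp: monotone_on_def G_def)
  show "antimono_on {0..} H"
    using p \<open>0 < a\<close> by (auto simp: monotone_on_def H_def intro!: divide_right_mono max.mono mono)
  show "0 \<le> H y" for y using p by (simp add: H_def)
  have "a \<le> a * exp h" using assms by simp
  then show "H (a * exp h) = 0" by (simp add: H_def max_absorb2)
  have "G (a * exp h) = exp (- \<kappa> * h) * G a"
    unfolding G_def using \<open>0 < a\<close> by (rule Q_class_tail_scale[OF q(1)])
  moreover have "0 \<le> G a" unfolding G_def using \<open>0 < a\<close> by (rule Q_class_tail_nonneg[OF q(1)])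
  \<comment> \<open>The normalising denominator of \<open>H\<close> cancels this factor, so the mass
    assigned to the positive half-line is \<open>G a\<close>.\<close>
  ultimately have "G a - G (a * exp h) = (1 - exp (- \<kappa> * h)) * G a" "0 \<le> (1 - exp (- \<kappa> * h)) * G a"
    using p by (simp_all add: algebra_simps mult_left_le)
  then have "H 0 = (1 - exp (- \<kappa> * h)) * G a / (1 - exp (- \<kappa> * h))"
    using \<open>0 < a\<close> by (simp add: H_def max_absorb1 max_absorb2)
  then show "H 0 = G a" using p \<kappa> h by simp
  fix y :: real
  \<comment> \<open>To the left of \<open>a\<close> the function is locally constant; from
    \<open>a\<close> on it coincides with \<open>G\<close>.\<close>
  have "continuous (at_right y) (\<lambda>y. G (max a y))"
  proof (cases "y < a")
    case True
    have "eventually (\<lambda>z. G a = G (max a z)) (at_right y)"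
      using True by (auto simp: eventually_at_right_field intro!: exI[of _ a])
    then have "((\<lambda>y. G (max a y)) \<longlongrightarrow> G a) (at_right y)"
      by (rule Lim_transform_eventually[OF tendsto_const])
    then show ?thesis using True by (simp add: continuous_within max_absorb1)
  next
    case False
    have "(G \<longlongrightarrow> G y) (at_right y)"
      using Q_class_tail_right_continuous[OF q, of y] False \<open>0 < a\<close>
      by (simp add: continuous_within G_def)
    moreover have "eventually (\<lambda>z. G z = G (max a z)) (at_right y)"
      using False by (auto simp: eventually_at_right_field max_absorb2 intro!: exI[of _ "y + 1"])
    ultimately have "((\<lambda>y. G (max a y)) \<longlongrightarrow> G y) (at_right y)"
      by (rule Lim_transform_eventually)
    then show ?thesis using False by (simp add: continuous_within max_absorb2)
  qed
  then show "continuous (at_right y) H"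
    unfolding H_def using p by (intro continuous_intros) auto
qed

section \<open>Realising two prescribed tails by one environment\<close>

text \<open>The environment is fixed before \<open>\<Phi>\<close>, which enters only through its
  behaviour at thresholds. Positive thresholds act alike for the affine and the maximum equation.
  The conditions at negative thresholds are premises of the lower-tail claim alone, because the
  maximum with 0 never falls below a negative level.\<close>

lemma ex_restart_env_with_tails:
  fixes \<kappa> h :: real and q1 q2 :: "real \<Rightarrow> real"
  assumes \<kappa>: "0 < \<kappa>" and h: "0 < h"
    and q1: "q1 \<in> Q_class \<kappa> h" "right_continuous q1"
    and q2: "q2 \<in> Q_class \<kappa> h" "right_continuous q2"
  obtains M :: "(real \<times> real) measure" where "admissible \<kappa> h M fst snd"
    "\<And>\<Phi>. (\<lambda>(w, x). \<Phi> w x) \<in> (borel \<Otimes>\<^sub>M borel) \<Otimes>\<^sub>M borel \<rightarrow>\<^sub>M borel \<Longrightarrow>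
      (\<And>y x. \<Phi> (0, y) x = \<Phi> (0, y) 0) \<Longrightarrow>
      (\<And>x t. 0 < t \<Longrightarrow> t < \<Phi> (exp h, 0) x \<longleftrightarrow> t < exp h * x) \<Longrightarrow>
      (\<And>y t. 0 < t \<Longrightarrow> t < \<Phi> (0, y) 0 \<longleftrightarrow> t < y) \<Longrightarrow>
      \<exists>N. unique_solution_law M \<Phi> N \<and>
        (\<forall>x>0. (\<lambda>n. x powr \<kappa> * exp (\<kappa> * real n * h) * measure N {y. y > x * exp (real n * h)})
          \<longlonglongrightarrow> q1 x) \<and>
        ((\<forall>x t. t < 0 \<longrightarrow> \<Phi> (exp h, 0) x < t \<longleftrightarrow> exp h * x < t) \<longrightarrow>
         (\<forall>y t. t < 0 \<longrightarrow> \<Phi> (0, y) 0 < t \<longleftrightarrow> y < t) \<longrightarrow>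
         (\<forall>x>0. (\<lambda>n. x powr \<kappa> * exp (\<kappa> * real n * h) * measure N {y. y < - (x * exp (real n * h))})
           \<longlonglongrightarrow> q2 x))"
proof -
  define p c where "p = exp (- \<kappa> * h)" and "c = exp h"
  have p: "0 < p" "p < 1" and c: "1 < c" and pc: "p * c powr \<kappa> = 1"
    using \<kappa> h by (auto simp: p_def c_def powr_def exp_add[symmetric])
  define G1 G2 where "G1 y = y powr (- \<kappa>) * q1 y" and "G2 y = y powr (- \<kappa>) * q2 y" for y
  have G1: "antimono_on {0<..} G1" "\<And>y. 0 < y \<Longrightarrow> 0 \<le> G1 y"
      "\<And>y. 0 < y \<Longrightarrow> G1 (y * c) = p * G1 y"
    using Q_class_tail_antimono[OF q1(1)] Q_class_tail_nonneg[OF q1(1)] Q_class_tail_scale[OF q1(1)]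
    unfolding G1_def p_def c_def by simp_all
  have G2: "antimono_on {0<..} G2" "\<And>y. 0 < y \<Longrightarrow> 0 \<le> G2 y"
      "\<And>y. 0 < y \<Longrightarrow> G2 (y * c) = p * G2 y"
    using Q_class_tail_antimono[OF q2(1)] Q_class_tail_nonneg[OF q2(1)] Q_class_tail_scale[OF q2(1)]
    unfolding G2_def p_def c_def by simp_all
  \<comment> \<open>Take \<open>a = exp (n * h)\<close>: both tails shrink by \<open>p\<close> per
    period, so a large \<open>n\<close> makes room for the masses \<open>H1 0 = G1 a\<close> and
    \<open>H2 0 = G2 a\<close> in one probability law.\<close>
  obtain a where a: "0 < a" "G1 a + G2 a \<le> 1"
  proof -
    have "(\<lambda>n. p ^ n * (G1 1 + G2 1)) \<longlonglongrightarrow> 0"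
      using p by (intro tendsto_mult_left_zero LIMSEQ_realpow_zero) auto
    then have "eventually (\<lambda>n. p ^ n * (G1 1 + G2 1) < 1) sequentially"
      by (rule order_tendstoD) simp
    then obtain n where "p ^ n * (G1 1 + G2 1) < 1" by (auto simp: eventually_sequentially)
    then have "G1 (exp (real n * h)) + G2 (exp (real n * h)) \<le> 1"
      using Q_class_tail_scale_power[OF q1(1), of 1 n] Q_class_tail_scale_power[OF q2(1), of 1 n]
      by (simp add: G1_def G2_def p_def algebra_simps)
    then show thesis by (intro that) auto
  qed
  let ?b = "a * c"
  define H1 H2 where "H1 y = max 0 (G1 (max a y) - G1 ?b) / (1 - p)"
    and "H2 y = max 0 (G2 (max a y) - G2 ?b) / (1 - p)" for y
  note tail1 = Q_class_restart_tail[OF q1 \<kappa> h a(1), folded G1_def p_def c_def, folded H1_def]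
  note tail2 = Q_class_restart_tail[OF q2 \<kappa> h a(1), folded G2_def p_def c_def, folded H2_def]
  have b: "0 \<le> ?b" using a c by simp
  have total: "H1 0 + H2 0 \<le> 1" using a tail1(5) tail2(5) by simp
  obtain \<rho> :: "real measure" where \<rho>: "prob_space \<rho>" "sets \<rho> = sets borel"
    "\<And>y. 0 \<le> y \<Longrightarrow> measure \<rho> {y<..} = H1 y" "\<And>y. 0 \<le> y \<Longrightarrow> measure \<rho> {..<- y} = H2 y"
    using ex_law_with_tails[OF tail1(1,2) tail2(1,2) tail1(3) tail2(3) b tail1(4) tail2(4) total] by metis
  interpret \<rho>: prob_space \<rho> by fact
  \<comment> \<open>Both tails of \<open>\<rho>\<close> vanish at \<open>a * c\<close>, so the
    restart variable is bounded.\<close>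
  have "AE y in \<rho>. y \<notin> {?b<..}" "AE y in \<rho>. y \<notin> {..<- ?b}"
    using \<rho>(3,4)[OF b] tail1(4) tail2(4)
    by (simp_all only: \<rho>.prob_eq_0[symmetric] \<rho>(2) greaterThan_borel lessThan_borel)
  then have bdd: "AE y in \<rho>. \<bar>y\<bar> \<le> ?b" by eventually_elim auto
  let ?M = "restart_env p c \<rho>"
  show thesis
  proof
    show "admissible \<kappa> h ?M fst snd"
      using admissible_restart_env[OF p c \<rho>(1,2) pc \<kappa> bdd] by (simp add: c_def)
    fix \<Phi> :: "real \<times> real \<Rightarrow> real \<Rightarrow> real"
    assume \<Phi>: "(\<lambda>(w, x). \<Phi> w x) \<in> (borel \<Otimes>\<^sub>M borel) \<Otimes>\<^sub>M borel \<rightarrow>\<^sub>M borel"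
      and restart: "\<And>y x. \<Phi> (0, y) x = \<Phi> (0, y) 0"
      and up: "\<And>x t. 0 < t \<Longrightarrow> t < \<Phi> (exp h, 0) x \<longleftrightarrow> t < exp h * x"
        "\<And>y t. 0 < t \<Longrightarrow> t < \<Phi> (0, y) 0 \<longleftrightarrow> t < y"
    obtain N where N: "unique_solution_law ?M \<Phi> N" "prob_space N"
      "\<And>S. S \<in> sets borel \<Longrightarrow> measure N S =
         p * measure N (\<Phi> (c, 0) -` S) + (1 - p) * measure \<rho> ((\<lambda>y. \<Phi> (0, y) 0) -` S)"
      using ex_unique_solution_restart_env[OF p c \<rho>(1,2) \<Phi> restart] by metis
    interpret N: prob_space N by fact
    have T1: "measure N {y<..} = max a y powr (- \<kappa>) * q1 (max a y)" if y: "0 < y" for y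
    proof -
      \<comment> \<open>The weight \<open>1 - p\<close> of the restart branch cancels the
        denominator in \<open>H1\<close>, which leaves exactly the recursion of
        \<open>tail_recursion_solution\<close>.\<close>
      have "measure N {z<..} = p * measure N {z / c<..} + max 0 (G1 (max a z) - G1 ?b)"
        if z: "0 < z" for z
      proof -
        have "\<Phi> (c, 0) -` {z<..} = {z / c<..}" "(\<lambda>y. \<Phi> (0, y) 0) -` {z<..} = {z<..}"
          using up z c by (auto simp: c_def field_simps)
        then show ?thesis using N(3)[of "{z<..}"] \<rho>(3)[of z] z p by (simp add: H1_def)
      qed
      then show ?thesis unfolding G1_def[symmetric]
        by (intro tail_recursion_solution[where T="\<lambda>y. measure N {y<..}" and G=G1, OF p c a(1) G1] y) auto
    qed
    have T2: "measure N {..<- y} = max a y powr (- \<kappa>) * q2 (max a y)"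
      if lo: "\<And>x t. t < 0 \<Longrightarrow> \<Phi> (exp h, 0) x < t \<longleftrightarrow> exp h * x < t"
        "\<And>y t. t < 0 \<Longrightarrow> \<Phi> (0, y) 0 < t \<longleftrightarrow> y < t" and y: "0 < y" for y
    proof -
      have "measure N {..<- z} = p * measure N {..<- (z / c)} + max 0 (G2 (max a z) - G2 ?b)"
        if z: "0 < z" for z
      proof -
        have "\<Phi> (c, 0) -` {..<- z} = {..<- (z / c)}" "(\<lambda>y. \<Phi> (0, y) 0) -` {..<- z} = {..<- z}"
          using lo z c by (auto simp: c_def field_simps)
        then show ?thesis using N(3)[of "{..<- z}"] \<rho>(4)[of z] z p by (simp add: H2_def)
      qed
      then show ?thesis unfolding G2_def[symmetric]
        by (intro tail_recursion_solution[where T="\<lambda>y. measure N {..<- y}" and G=G2, OF p c a(1) G2] y) auto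
    qed
    show "\<exists>N. unique_solution_law ?M \<Phi> N \<and>
        (\<forall>x>0. (\<lambda>n. x powr \<kappa> * exp (\<kappa> * real n * h) * measure N {y. y > x * exp (real n * h)})
          \<longlonglongrightarrow> q1 x) \<and>
        ((\<forall>x t. t < 0 \<longrightarrow> \<Phi> (exp h, 0) x < t \<longleftrightarrow> exp h * x < t) \<longrightarrow>
         (\<forall>y t. t < 0 \<longrightarrow> \<Phi> (0, y) 0 < t \<longleftrightarrow> y < t) \<longrightarrow>
         (\<forall>x>0. (\<lambda>n. x powr \<kappa> * exp (\<kappa> * real n * h) * measure N {y. y < - (x * exp (real n * h))})
           \<longlonglongrightarrow> q2 x))"
    proof (intro exI[of _ N] conjI allI impI N(1))
      fix x :: real assume x: "0 < x"
      show "(\<lambda>n. x powr \<kappa> * exp (\<kappa> * real n * h) * measure N {y. y > x * exp (real n * h)})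
          \<longlonglongrightarrow> q1 x"
        using Q_class_tail_limit[where T="\<lambda>y. measure N {y<..}", OF q1(1) h x T1]
        by (simp add: greaterThan_def)
      assume "\<forall>x t. t < 0 \<longrightarrow> \<Phi> (exp h, 0) x < t \<longleftrightarrow> exp h * x < t"
        "\<forall>y t. t < 0 \<longrightarrow> \<Phi> (0, y) 0 < t \<longleftrightarrow> y < t"
      then show "(\<lambda>n. x powr \<kappa> * exp (\<kappa> * real n * h) * measure N {y. y < - (x * exp (real n * h))})
          \<longlonglongrightarrow> q2 x"
        using Q_class_tail_limit[where T="\<lambda>y. measure N {..<- y}", OF q2(1) h x T2]
        by (simp add: lessThan_def)
    qed
  qed
qed

theorem proposition1:
  fixes \<kappa> h :: real and q q1 q2 :: "real \<Rightarrow> real"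
  assumes "\<kappa> > 0" and "h > 0"
    and "q \<in> Q_class \<kappa> h" and "q1 \<in> Q_class \<kappa> h" and "q2 \<in> Q_class \<kappa> h"
    and "right_continuous q" and "right_continuous q1" and "right_continuous q2"
    and "\<exists>x>0. q x \<noteq> 0" and "\<exists>x>0. q1 x + q2 x \<noteq> 0"
  shows "(\<exists>(M :: (real \<times> real) measure) A B N.
            admissible \<kappa> h M A B
            \<and> unique_solution_law M (\<lambda>w x. A w * x + B w) N
            \<and> (\<forall>x \<in> continuity_points q1.
                (\<lambda>n. x powr \<kappa> * exp (\<kappa> * real n * h) * measure N {y. y > x * exp (real n * h)})
                  \<longlonglongrightarrow> q1 x)
            \<and> (\<forall>x \<in> continuity_points q2.
                (\<lambda>n. x powr \<kappa> * exp (\<kappa> * real n * h) * measure N {y. y < - (x * exp (real n * h))})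
                  \<longlonglongrightarrow> q2 x))
       \<and> (\<exists>(M :: (real \<times> real) measure) A B N.
            admissible \<kappa> h M A B
            \<and> unique_solution_law M (\<lambda>w x. max (A w * x) (B w)) N
            \<and> (\<forall>x>0.
                (\<lambda>n. x powr \<kappa> * exp (\<kappa> * real n * h) * measure N {y. y > x * exp (real n * h)})
                  \<longlonglongrightarrow> q x))"
proof
  note \<kappa> = assms(1) and h = assms(2)
  obtain M :: "(real \<times> real) measure" where M: "admissible \<kappa> h M fst snd"
    and sol: "\<exists>N. unique_solution_law M (\<lambda>w x. fst w * x + snd w) N \<and>
        (\<forall>x>0. (\<lambda>n. x powr \<kappa> * exp (\<kappa> * real n * h) * measure N {y. y > x * exp (real n * h)})
          \<longlonglongrightarrow> q1 x) \<and>
         (\<forall>x>0. (\<lambda>n. x powr \<kappa> * exp (\<kappa> * real n * h) * measure N {y. y < - (x * exp (real n * h))})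
           \<longlonglongrightarrow> q2 x)"
  proof (rule ex_restart_env_with_tails[OF \<kappa> h assms(4,7,5,8)], goal_cases)
    case (1 M)
    from 1(3)[of "\<lambda>w x. fst w * x + snd w"] show ?case by (intro 1(1)[OF 1(2)]) auto
  qed
  then show "\<exists>(M :: (real \<times> real) measure) A B N.
            admissible \<kappa> h M A B
            \<and> unique_solution_law M (\<lambda>w x. A w * x + B w) N
            \<and> (\<forall>x \<in> continuity_points q1.
                (\<lambda>n. x powr \<kappa> * exp (\<kappa> * real n * h) * measure N {y. y > x * exp (real n * h)})
                  \<longlonglongrightarrow> q1 x)
            \<and> (\<forall>x \<in> continuity_points q2.
                (\<lambda>n. x powr \<kappa> * exp (\<kappa> * real n * h) * measure N {y. y < - (x * exp (real n * h))})
                  \<longlonglongrightarrow> q2 x)"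
    \<comment> \<open>The limits hold at every \<open>x > 0\<close>, in particular at the continuity
      points.\<close>
    unfolding continuity_points_def by blast
next
  note \<kappa> = assms(1) and h = assms(2)
  \<comment> \<open>Only the upper tail is prescribed for the maximum equation, so the lower one is
    set to 0, which makes the restart variable almost surely nonnegative.\<close>
  have zero: "(\<lambda>_. 0) \<in> Q_class \<kappa> h" "right_continuous (\<lambda>_. 0)"
    by (auto simp: Q_class_def right_continuous_def monotone_on_def)
  obtain M :: "(real \<times> real) measure" where M: "admissible \<kappa> h M fst snd"
    and sol: "\<exists>N. unique_solution_law M (\<lambda>w x. max (fst w * x) (snd w)) N \<and>
        (\<forall>x>0. (\<lambda>n. x powr \<kappa> * exp (\<kappa> * real n * h) * measure N {y. y > x * exp (real n * h)})
          \<longlonglongrightarrow> q x)"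
  proof (rule ex_restart_env_with_tails[OF \<kappa> h assms(3,6) zero], goal_cases)
    case (1 M)
    from 1(3)[of "\<lambda>w x. max (fst w * x) (snd w)"] show ?case
      by (intro 1(1)[OF 1(2)]) (auto simp: less_max_iff_disj)
  qed
  then show "\<exists>(M :: (real \<times> real) measure) A B N.
            admissible \<kappa> h M A B
            \<and> unique_solution_law M (\<lambda>w x. max (A w * x) (B w)) N
            \<and> (\<forall>x>0.
                (\<lambda>n. x powr \<kappa> * exp (\<kappa> * real n * h) * measure N {y. y > x * exp (real n * h)})
                  \<longlonglongrightarrow> q x)"
    by blast
qed

end
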